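(* Let $X$ be a connected CW-complex and let $n\ge 2$. Then: (1) $\mathrm{TC}^\Sigma_n(X)\ge \mathrm{secat}(X\to SP^n(X))$; (2) $\mathrm{TC}^\beta_n(X)\ge \mathrm{secat}(X\to \beta P^n(X))$; and (3) $\mathrm{secat}(\beta P^n(X)\to SP^n(X))\le \mathrm{secat}(X\to SP^n(X))$. Here $X\to SP^n(X)$ and $X\to\beta P^n(X)$ are the diagonal maps (induced by $x\mapsto(x,\ldots,x)$) and $\beta P^n(X)\to SP^n(X)$ is the natural quotient map.
   Context: Let $I=[0,1]$. The symmetric group $\Sigma_n$ acts on $X^n$ by permuting components, and $\beta\in\Sigma_n$ is the permutation $\beta(i)=n+1-i$, so $\beta\cdot(x_1,\ldots,x_n)=(x_n,\ldots,x_1)$. Put $SP^n(X)=X^n/\Sigma_n$ (symmetric product) and $\beta P^n(X)=X^n/\langle\beta\rangle$ (bidirectional product). The sectional category $\mathrm{secat}(p)$ of a map $p\colon E\to B$ is the least integer $k$ such that $B$ is covered by $k$ open sets $U$ on each of which there is a map $s\colon U\to E$ with $p\circ s$ homotopic to the inclusion $U\hookrightarrow B$ (unreduced convention). Let $e\colon X^I\to X^n$ be $\alpha\mapsto\left(\alpha(0),\alpha(\tfrac{1}{n-1}),\ldots,\alpha(\tfrac{n-2}{n-1}),\alpha(1)\right)$, and let $\beta$ act on $X^I$ by $(\beta\cdot\alpha)(t)=\alpha(1-t)$. $\mathrm{TC}^\beta_n(X)$ is the smallest number of open subsets $U$ with $\beta(U)=U$ covering $X^n$ on each of which there is a continuous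 $\beta$-equivariant map $s\colon U\to X^I$ with $e\circ s$ equal to the inclusion $U\hookrightarrow X^n$. Let $J_n$ be the wedge of $n$ copies of $I$, each with base point $0$, so that a point of $X^{J_n}$ is an $n$-tuple of paths $(\alpha_1,\ldots,\alpha_n)$ in $X$ with $\alpha_i(0)=\alpha_j(0)$ for all $i,j$; let $e'\colon X^{J_n}\to X^n$ be $(\alpha_1,\ldots,\alpha_n)\mapsto(\alpha_1(1),\ldots,\alpha_n(1))$, with $\Sigma_n$ acting on $X^{J_n}$ by permuting components. $\mathrm{TC}^\Sigma_n(X)$ is the smallest number of $\Sigma_n$-invariant open subsets $U$ covering $X^n$ on each of which there is a continuous $\Sigma_n$-equivariant map $s\colon U\to X^{J_n}$ with $e'\circ s$ equal to the inclusion. *)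

theory Defs
  imports "HOL-Analysis.Analysis" "HOL-Algebra.Sym_Groups" "HOL-Algebra.Elementary_Groups"
    "HOL-Algebra.Group_Action"
begin

section \<open>CW-complexes\<close>

text \<open>The closed \<open>k\<close>-disc, its interior and its boundary sphere in the library's
  \<^term>\<open>Euclidean_space k\<close>; for \<open>k = 0\<close> the sphere is empty.\<close>

definition closed_disc :: "nat \<Rightarrow> (nat \<Rightarrow> real) set" where
  "closed_disc k = {x \<in> topspace (Euclidean_space k). (\<Sum>i<k. (x i)\<^sup>2) \<le> 1}"

definition open_disc :: "nat \<Rightarrow> (nat \<Rightarrow> real) set" where
  "open_disc k = {x \<in> topspace (Euclidean_space k). (\<Sum>i<k. (x i)\<^sup>2) < 1}"

definition disc_boundary :: "nat \<Rightarrow> (nat \<Rightarrow> real) set" where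
  "disc_boundary k = {x \<in> topspace (Euclidean_space k). (\<Sum>i<k. (x i)\<^sup>2) = 1}"

text \<open>Whitehead's definition: a Hausdorff space partitioned into open cells, each with a dimension
  and a characteristic map, closure-finite and carrying the weak topology.  Since open cells
  are nonempty and pairwise disjoint, indexing the cells by the cells themselves is no loss.
  In a Hausdorff space \<open>\<Phi> e ` closed_disc (d e)\<close> is the closure of the cell \<open>e\<close>.\<close>

definition CW_complex :: "'a topology \<Rightarrow> bool" where
  "CW_complex X \<longleftrightarrow> Hausdorff_space X \<and>
    (\<exists>(C :: 'a set set) (d :: 'a set \<Rightarrow> nat) (\<Phi> :: 'a set \<Rightarrow> (nat \<Rightarrow> real) \<Rightarrow> 'a).
      \<Union>C = topspace X \<and> pairwise disjnt C \<and>
      (\<forall>e\<in>C.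
        continuous_map (subtopology (Euclidean_space (d e)) (closed_disc (d e))) X (\<Phi> e) \<and>
        homeomorphic_map (subtopology (Euclidean_space (d e)) (open_disc (d e)))
                         (subtopology X e) (\<Phi> e) \<and>
        (\<exists>F. finite F \<and> F \<subseteq> {e'\<in>C. d e' < d e} \<and> \<Phi> e ` disc_boundary (d e) \<subseteq> \<Union>F)) \<and>
      (\<forall>A. A \<subseteq> topspace X \<longrightarrow>
        (\<forall>e\<in>C. closedin X (A \<inter> \<Phi> e ` closed_disc (d e))) \<longrightarrow> closedin X A))"


section \<open>Quotient topologies and mapping spaces\<close>

definition quotient_topology :: "'a topology \<Rightarrow> ('a \<Rightarrow> 'b) \<Rightarrow> 'b topology" where
  "quotient_topology X q =
    topology (\<lambda>V. V \<subseteq> q ` topspace X \<and> openin X {x \<in> topspace X. q x \<in> V})"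

lemma openin_quotient_topology:
  "openin (quotient_topology X q) V \<longleftrightarrow>
    V \<subseteq> q ` topspace X \<and> openin X {x \<in> topspace X. q x \<in> V}"
proof -
  have "istopology (\<lambda>V. V \<subseteq> q ` topspace X \<and> openin X {x \<in> topspace X. q x \<in> V})"
    unfolding istopology_def
  proof (intro conjI allI impI)
    fix S T
    assume S: "S \<subseteq> q ` topspace X \<and> openin X {x \<in> topspace X. q x \<in> S}"
      and T: "T \<subseteq> q ` topspace X \<and> openin X {x \<in> topspace X. q x \<in> T}"
    have "{x \<in> topspace X. q x \<in> S \<inter> T} =
        {x \<in> topspace X. q x \<in> S} \<inter> {x \<in> topspace X. q x \<in> T}" by auto
    with S T show "openin X {x \<in> topspace X. q x \<in> S \<inter> T}" by auto
    show "S \<inter> T \<subseteq> q ` topspace X" using S by blast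
  next
    fix \<K>
    assume K: "\<forall>K\<in>\<K>. K \<subseteq> q ` topspace X \<and> openin X {x \<in> topspace X. q x \<in> K}"
    have "{x \<in> topspace X. q x \<in> \<Union>\<K>} = (\<Union>K\<in>\<K>. {x \<in> topspace X. q x \<in> K})" by auto
    with K show "openin X {x \<in> topspace X. q x \<in> \<Union>\<K>}" by auto
    show "\<Union>\<K> \<subseteq> q ` topspace X" using K by blast
  qed
  then show ?thesis
    unfolding quotient_topology_def by (simp add: topology_inverse')
qed

lemma topspace_quotient_topology: "topspace (quotient_topology X q) = q ` topspace X"
proof -
  have "{x \<in> topspace X. q x \<in> q ` topspace X} = topspace X" by auto
  then have "openin (quotient_topology X q) (q ` topspace X)"
    by (simp add: openin_quotient_topology)
  then show ?thesis
    by (meson openin_quotient_topology openin_subset openin_topspace subset_antisym)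
qed

lemma quotient_map_quotient_topology: "quotient_map X (quotient_topology X q) q"
  by (simp add: quotient_map_def topspace_quotient_topology openin_quotient_topology)

text \<open>The space of continuous maps from \<open>Y\<close> to \<open>X\<close> with the compact-open topology.  Maps are taken
  extensional, so that points are functions on \<^term>\<open>topspace Y\<close> only.\<close>

definition map_set :: "'a topology \<Rightarrow> 'b topology \<Rightarrow> ('a \<Rightarrow> 'b) set" where
  "map_set Y X = {f \<in> extensional (topspace Y). continuous_map Y X f}"

definition mapping_space :: "'a topology \<Rightarrow> 'b topology \<Rightarrow> ('a \<Rightarrow> 'b) topology" where
  "mapping_space Y X =
    topology_generated_by {{f \<in> map_set Y X. f ` K \<subseteq> U} | K U. compactin Y K \<and> openin X U}"

abbreviation unit_interval :: "real topology" where
  "unit_interval \<equiv> top_of_set {0..1}"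

definition path_space :: "'a topology \<Rightarrow> (real \<Rightarrow> 'a) topology" where
  "path_space X = mapping_space unit_interval X"


section \<open>Powers, symmetric products and bidirectional products\<close>

definition power_space :: "nat \<Rightarrow> 'a topology \<Rightarrow> (nat \<Rightarrow> 'a) topology" where
  "power_space n X = product_topology (\<lambda>_. X) {1..n}"

text \<open>The left action by permuting components: the \<open>i\<close>-th entry is moved to position \<open>p i\<close>.\<close>

definition perm_act :: "nat \<Rightarrow> (nat \<Rightarrow> nat) \<Rightarrow> (nat \<Rightarrow> 'a) \<Rightarrow> nat \<Rightarrow> 'a" where
  "perm_act n p x = (\<lambda>i\<in>{1..n}. x (inv_into UNIV p i))"

definition beta_perm :: "nat \<Rightarrow> nat \<Rightarrow> nat" where
  "beta_perm n i = (if i \<in> {1..n} then n + 1 - i else i)"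

abbreviation beta_group :: "nat \<Rightarrow> (nat \<Rightarrow> nat) monoid" where
  "beta_group n \<equiv> subgroup_generated (sym_group n) {beta_perm n}"

definition SP :: "nat \<Rightarrow> 'a topology \<Rightarrow> (nat \<Rightarrow> 'a) set topology" where
  "SP n X = quotient_topology (power_space n X) (orbit (sym_group n) (perm_act n))"

definition betaP :: "nat \<Rightarrow> 'a topology \<Rightarrow> (nat \<Rightarrow> 'a) set topology" where
  "betaP n X = quotient_topology (power_space n X) (orbit (beta_group n) (perm_act n))"

definition diag_SP :: "nat \<Rightarrow> 'a \<Rightarrow> (nat \<Rightarrow> 'a) set" where
  "diag_SP n x = orbit (sym_group n) (perm_act n) (\<lambda>i\<in>{1..n}. x)"

definition diag_betaP :: "nat \<Rightarrow> 'a \<Rightarrow> (nat \<Rightarrow> 'a) set" where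
  "diag_betaP n x = orbit (beta_group n) (perm_act n) (\<lambda>i\<in>{1..n}. x)"

text \<open>All points of a \<open>\<beta>\<close>-orbit \<open>c\<close> have the same \<open>\<Sigma>\<^sub>n\<close>-orbit, which is therefore this union.\<close>

definition betaP_to_SP :: "nat \<Rightarrow> (nat \<Rightarrow> 'a) set \<Rightarrow> (nat \<Rightarrow> 'a) set" where
  "betaP_to_SP n c = (\<Union>x\<in>c. orbit (sym_group n) (perm_act n) x)"


section \<open>Sectional category and symmetric topological complexities\<close>

text \<open>The least number of open sets with property \<open>P\<close> covering \<open>B\<close>; it is \<open>\<infinity>\<close> if there is no
  finite cover of this kind.\<close>

definition cover_number :: "'b topology \<Rightarrow> ('b set \<Rightarrow> bool) \<Rightarrow> enat" where
  "cover_number B P =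
    Inf {enat k | k. \<exists>U :: nat \<Rightarrow> 'b set.
      (\<forall>i<k. openin B (U i) \<and> P (U i)) \<and> (\<Union>i<k. U i) = topspace B}"

definition secat :: "'e topology \<Rightarrow> 'b topology \<Rightarrow> ('e \<Rightarrow> 'b) \<Rightarrow> enat" where
  "secat E B p = cover_number B (\<lambda>U. \<exists>s. continuous_map (subtopology B U) E s \<and>
     homotopic_with (\<lambda>_. True) (subtopology B U) B (p \<circ> s) id)"

definition path_eval :: "nat \<Rightarrow> (real \<Rightarrow> 'a) \<Rightarrow> nat \<Rightarrow> 'a" where
  "path_eval n \<alpha> = (\<lambda>i\<in>{1..n}. \<alpha> ((real i - 1) / (real n - 1)))"

definition path_rev :: "(real \<Rightarrow> 'a) \<Rightarrow> real \<Rightarrow> 'a" where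
  "path_rev \<alpha> = (\<lambda>t\<in>{0..1}. \<alpha> (1 - t))"

definition TC_beta :: "nat \<Rightarrow> 'a topology \<Rightarrow> enat" where
  "TC_beta n X = cover_number (power_space n X) (\<lambda>U.
     perm_act n (beta_perm n) ` U = U \<and>
     (\<exists>s. continuous_map (subtopology (power_space n X) U) (path_space X) s \<and>
        (\<forall>x\<in>U. s (perm_act n (beta_perm n) x) = path_rev (s x)) \<and>
        (\<forall>x\<in>U. path_eval n (s x) = x)))"

text \<open>The wedge \<open>J\<^sub>n\<close> is the disjoint union of \<open>n\<close> intervals \<open>{i} \<times> [0,1]\<close> with the points \<open>(i, 0)\<close>
  identified.  A point \<open>f\<close> of \<open>X\<^bsup>J\<^sub>n\<^esup>\<close> corresponds to the tuple of paths
  \<open>\<alpha>\<^sub>i(t) = f (wedge_class n (i, t))\<close>.\<close>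

definition wedge_class :: "nat \<Rightarrow> nat \<times> real \<Rightarrow> (nat \<times> real) set" where
  "wedge_class n = (\<lambda>(i, t). if t = 0 then {1..n} \<times> {0} else {(i, t)})"

definition wedge_space :: "nat \<Rightarrow> (nat \<times> real) set topology" where
  "wedge_space n = quotient_topology (sum_topology (\<lambda>_. unit_interval) {1..n}) (wedge_class n)"

definition wedge_eval :: "nat \<Rightarrow> ((nat \<times> real) set \<Rightarrow> 'a) \<Rightarrow> nat \<Rightarrow> 'a" where
  "wedge_eval n f = (\<lambda>i\<in>{1..n}. f (wedge_class n (i, 1)))"

text \<open>In terms of tuples, \<open>p\<close> sends \<open>(\<alpha>\<^sub>i)\<close> to the tuple whose \<open>i\<close>-th component is \<open>\<alpha>\<close> at index
  \<open>p\<^sup>-\<^sup>1 i\<close>, as in \<^const>\<open>perm_act\<close>.\<close>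

definition wedge_perm_act ::
    "nat \<Rightarrow> (nat \<Rightarrow> nat) \<Rightarrow> ((nat \<times> real) set \<Rightarrow> 'a) \<Rightarrow> (nat \<times> real) set \<Rightarrow> 'a" where
  "wedge_perm_act n p f =
    (\<lambda>c\<in>topspace (wedge_space n). f ((\<lambda>(i, t). (inv_into UNIV p i, t)) ` c))"

definition TC_Sigma :: "nat \<Rightarrow> 'a topology \<Rightarrow> enat" where
  "TC_Sigma n X = cover_number (power_space n X) (\<lambda>U.
     (\<forall>p\<in>carrier (sym_group n). perm_act n p ` U = U) \<and>
     (\<exists>s. continuous_map (subtopology (power_space n X) U) (mapping_space (wedge_space n) X) s \<and>
        (\<forall>p\<in>carrier (sym_group n). \<forall>x\<in>U. s (perm_act n p x) = wedge_perm_act n p (s x)) \<and>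
        (\<forall>x\<in>U. wedge_eval n (s x) = x)))"

end

theory Submission
  imports Defs
begin

text \<open>
  An equivariant motion planner provides an equivariant way of contracting configurations to the
  diagonal, and whatever is equivariant descends to orbits.

  For a point \<open>x\<close> of an invariant open set \<open>U\<close>, the planner supplies a map \<open>s x\<close> of a space \<open>Z\<close>
  (the wedge \<open>J\<^sub>n\<close> or the interval) into \<open>X\<close>, whose values at \<open>n\<close> marked points of \<open>Z\<close> are the
  entries of \<open>x\<close>.  Join the marked points to one point of \<open>Z\<close> that the group fixes, by paths \<open>\<gamma> i\<close>
  that the group permutes: in the wedge, run from the base point along the \<open>i\<close>-th interval; in
  \<open>[0,1]\<close> with the reversal \<open>t \<mapsto> 1 - t\<close>, run linearly from the midpoint to the \<open>i\<close>-th node.  Then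
  \<open>H(t, x) = (s x (\<gamma> i t))\<^sub>i\<close> is an equivariant homotopy from a map into the diagonal to the inclusion
  of \<open>U\<close>.  Passing to orbits, its start gives a map \<open>s'\<close> from \<open>U/G\<close> to \<open>X\<close>, and \<open>H\<close> itself gives a
  homotopy from \<open>s'\<close> followed by the diagonal to the inclusion of \<open>U/G\<close>.  Hence an invariant cover
  of \<open>X\<^sup>n\<close> with planners yields a cover of \<open>X\<^sup>n/G\<close> of the same size that counts for the sectional
  category of the diagonal.  The reduction to a contraction is
  \<open>equivariant_motion_planner_descends\<close>, the passage to orbits \<open>equivariant_contraction_descends\<close>;
  together they carry the first two inequalities.

  The third inequality holds because the diagonal \<open>X \<rightarrow> SP\<^sup>n(X)\<close> factors through \<open>\<beta>P\<^sup>n(X)\<close>, so a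
  homotopy section of it, followed by \<open>X \<rightarrow> \<beta>P\<^sup>n(X)\<close>, is a homotopy section of
  \<open>\<beta>P\<^sup>n(X) \<rightarrow> SP\<^sup>n(X)\<close> (\<open>secat_comp_le\<close>).
\<close>

section \<open>Comparing covering numbers\<close>

text \<open>Covers are pushed forward along \<open>q\<close> member by member.  In the applications \<open>q\<close> is an orbit map,
  or the identity when only the requirement on the open sets changes.\<close>

lemma cover_number_image_le:
  assumes good: "\<And>U. openin B U \<Longrightarrow> P U \<Longrightarrow> openin B' (q ` U) \<and> Q (q ` U)"
    and onto: "q ` topspace B = topspace B'"
  shows "cover_number B' Q \<le> cover_number B P"
  unfolding cover_number_def
proof (rule Inf_superset_mono, clarify)
  fix k and U :: "nat \<Rightarrow> 'a set"
  assume U: "\<forall>i<k. openin B (U i) \<and> P (U i)" "(\<Union>i<k. U i) = topspace B"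
  have "\<forall>i<k. openin B' (q ` U i) \<and> Q (q ` U i)"
    using U(1) good by blast
  moreover have "(\<Union>i<k. q ` U i) = topspace B'"
    using U(2) onto by (metis image_UN)
  ultimately show "\<exists>k'. enat k = enat k' \<and> (\<exists>U. (\<forall>i<k'. openin B' (U i) \<and> Q (U i)) \<and>
      (\<Union>i<k'. U i) = topspace B')"
    by (intro exI[of _ k] conjI refl exI[of _ "\<lambda>i. q ` U i"]) auto
qed

section \<open>Evaluation on mapping spaces\<close>

lemma locally_compact_unit_interval: "locally_compact_space unit_interval"
  by (simp add: compact_imp_locally_compact_space compact_space_subtopology)

lemma Hausdorff_unit_interval: "Hausdorff_space unit_interval"
  by (simp add: Hausdorff_space_subtopology)

lemma topspace_mapping_space: "topspace (mapping_space Z X) = map_set Z X"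
proof -
  \<comment> \<open>All continuous maps together form a subbasic open set, with the empty set as \<open>K\<close>.\<close>
  have "map_set Z X \<in> {{f \<in> map_set Z X. f ` K \<subseteq> U} | K U. compactin Z K \<and> openin X U}"
    by (rule CollectI, rule exI[of _ "{}"], rule exI[of _ "{}"]) auto
  then show ?thesis
    by (auto simp: mapping_space_def)
qed

text \<open>Local compactness of the parameter space \<open>T\<close> does the work here: compact neighbourhoods in \<open>T\<close>
  have compact images in \<open>Z\<close>, and such images define open sets of the compact-open topology.
  With \<open>T\<close> the unit interval, the lemma applies to the wedge directly, through the paths in it.\<close>

lemma continuous_map_eval_along:
  assumes F: "continuous_map Y (mapping_space Z X) F"
    and g: "continuous_map T Z g"
    and T: "locally_compact_space T" "Hausdorff_space T"
  shows "continuous_map (prod_topology T Y) X (\<lambda>(t, y). F y (g t))"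
proof -
  have FX: "continuous_map Z X (F y)" if "y \<in> topspace Y" for y
    using continuous_map_image_subset_topspace[OF F] that
    by (auto simp: topspace_mapping_space map_set_def)
  have base: "neighbourhood_base_of (compactin T) T"
    using T locally_compact_space_neighbourhood_base by blast
  show ?thesis
    unfolding continuous_map
  proof (intro conjI allI impI)
    show "(\<lambda>(t, y). F y (g t)) ` topspace (prod_topology T Y) \<subseteq> topspace X"
      using FX g by (fastforce simp: continuous_map_def Pi_iff)
    fix V
    assume V: "openin X V"
    let ?P = "{p \<in> topspace (prod_topology T Y). (case p of (t, y) \<Rightarrow> F y (g t)) \<in> V}"
    have "\<exists>W. openin (prod_topology T Y) W \<and> p \<in> W \<and> W \<subseteq> ?P" if "p \<in> ?P" for p
    proof -
      obtain t y where p: "p = (t, y)"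
        by (cases p)
      then have t: "t \<in> topspace T" and y: "y \<in> topspace Y" and ty: "F y (g t) \<in> V"
        using that by auto
      have "openin T {t' \<in> topspace T. (F y \<circ> g) t' \<in> V}"
        using continuous_map_compose[OF g FX[OF y]] V by (rule openin_continuous_map_preimage)
      then obtain N K where N: "openin T N" "t \<in> N" "N \<subseteq> K"
        and K: "compactin T K" "K \<subseteq> {t' \<in> topspace T. (F y \<circ> g) t' \<in> V}"
        using base t ty unfolding neighbourhood_base_of
        by (smt (verit, ccfv_threshold) comp_apply mem_Collect_eq)
      define W where "W = {f \<in> map_set Z X. f ` (g ` K) \<subseteq> V}"
      have "openin (mapping_space Z X) W"
        unfolding W_def mapping_space_def
        by (rule topology_generated_by_Basis) (use image_compactin[OF K(1) g] V in blast)
      then have "openin Y {y' \<in> topspace Y. F y' \<in> W}"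
        using F by (rule openin_continuous_map_preimage[rotated])
      then have "openin (prod_topology T Y) (N \<times> {y' \<in> topspace Y. F y' \<in> W})"
        using N by (simp add: openin_prod_Times_iff)
      moreover have "F y \<in> W"
        using continuous_map_image_subset_topspace[OF F] y K(2)
        by (auto simp: W_def topspace_mapping_space)
      moreover have "N \<times> {y' \<in> topspace Y. F y' \<in> W} \<subseteq> ?P"
        using N(3) K(2) by (auto simp: W_def image_subset_iff)
      ultimately show ?thesis
        using N p y by (intro exI[of _ "N \<times> {y' \<in> topspace Y. F y' \<in> W}"]) auto
    qed
    then show "openin (prod_topology T Y) ?P"
      by (intro openin_subopen[THEN iffD2] ballI)
  qed
qed

section \<open>Orbits of permutation actions\<close>

lemma topspace_power_space_extensional:
  "x \<in> topspace (power_space n X) \<Longrightarrow> x \<in> extensional {1..n}"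
  by (auto simp: power_space_def PiE_def)

lemma perm_act_id: "x \<in> extensional {1..n} \<Longrightarrow> perm_act n id x = x"
  unfolding perm_act_def by (auto simp: extensional_def restrict_def fun_eq_iff inv_id)

lemma inv_permutes_mem: "p permutes A \<Longrightarrow> i \<in> A \<Longrightarrow> inv_into UNIV p i \<in> A"
  by (simp add: permutes_in_image[OF permutes_inv])

lemma perm_act_compose:
  assumes "p permutes {1..n}" "q permutes {1..n}"
  shows "perm_act n p (perm_act n q x) = perm_act n (p \<circ> q) x"
proof -
  have "inv_into UNIV p i \<in> {1..n}" if "i \<in> {1..n}" for i
    using assms(1) that by (rule inv_permutes_mem)
  moreover have "inv_into UNIV (p \<circ> q) = inv_into UNIV q \<circ> inv_into UNIV p"
    using assms by (simp add: o_inv_distrib permutes_bij)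
  ultimately show ?thesis
    unfolding perm_act_def by (intro restrict_ext) simp
qed

text \<open>Below, a group \<open>G\<close> of permutations enters through its carrier being a subgroup of the symmetric
  group, which covers \<open>\<Sigma>\<^sub>n\<close> itself and the group generated by \<open>\<beta>\<close> alike.\<close>

lemma orbit_perm_act:
  assumes G: "subgroup (carrier G) (sym_group n)" and p: "p \<in> carrier G"
  shows "orbit G (perm_act n) (perm_act n p x) = orbit G (perm_act n) x"
proof -
  have perm: "g permutes {1..n}" if "g \<in> carrier G" for g
    using subgroup.mem_carrier[OF G that] by (simp add: sym_group_carrier)
  have mult: "g \<circ> h \<in> carrier G" if "g \<in> carrier G" "h \<in> carrier G" for g h
    using subgroup.m_closed[OF G that] by (simp add: sym_group_mult)
  have inv: "inv_into UNIV p \<in> carrier G"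
    using subgroup.m_inv_closed[OF G p] sym_group_inv_equality subgroup.mem_carrier[OF G p]
    by metis
  have left: "perm_act n g (perm_act n p x) = perm_act n (g \<circ> p) x" if "g \<in> carrier G" for g
    using perm[OF that] perm[OF p] by (rule perm_act_compose)
  have right: "perm_act n g x = perm_act n (g \<circ> inv_into UNIV p) (perm_act n p x)"
    if "g \<in> carrier G" for g
    using perm_act_compose[OF perm[OF mult[OF that inv]] perm[OF p], of x]
    by (simp add: comp_assoc permutes_inv_o(2)[OF perm[OF p]])
  show ?thesis
  proof
    show "orbit G (perm_act n) (perm_act n p x) \<subseteq> orbit G (perm_act n) x"
      unfolding orbit_def using left mult[OF _ p] by blast
    show "orbit G (perm_act n) x \<subseteq> orbit G (perm_act n) (perm_act n p x)"
      unfolding orbit_def using right mult[OF _ inv] by blast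
  qed
qed

lemma orbit_perm_act_eqD:
  assumes G: "subgroup (carrier G) (sym_group n)"
    and y: "y \<in> extensional {1..n}"
    and eq: "orbit G (perm_act n) x = orbit G (perm_act n) y"
  obtains p where "p \<in> carrier G" "y = perm_act n p x"
proof -
  have "id \<in> carrier G"
    using subgroup.one_closed[OF G] by (simp add: sym_group_one)
  then have "y \<in> orbit G (perm_act n) y"
    using perm_act_id[OF y] unfolding orbit_def by (intro CollectI exI[of _ id]) simp
  then have "y \<in> orbit G (perm_act n) x"
    using eq by simp
  then show ?thesis
    using that unfolding orbit_def by blast
qed

section \<open>Equivariant contractions descend to orbit spaces\<close>

text \<open>An invariant \<open>U\<close> is a union of orbits, so \<open>U \<rightarrow> U/G\<close> is again a quotient map, and so is its
  product with the interval.  The diagonal consists of fixed points; therefore the common entry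
  of \<open>H(0, x)\<close> depends only on the orbit of \<open>x\<close>, which gives the homotopy section \<open>s\<close>, while the orbit
  of \<open>H(t, x)\<close> depends only on \<open>t\<close> and the orbit of \<open>x\<close>, which gives the homotopy.\<close>

lemma equivariant_contraction_descends:
  fixes n :: nat and X :: "'a topology" and G :: "(nat \<Rightarrow> nat) monoid"
  defines "q \<equiv> orbit G (perm_act n)"
  defines "Q \<equiv> quotient_topology (power_space n X) q"
  assumes G: "subgroup (carrier G) (sym_group n)" and n: "1 \<le> n"
    and U: "openin (power_space n X) U"
    and inv: "\<And>p x. p \<in> carrier G \<Longrightarrow> x \<in> U \<Longrightarrow> perm_act n p x \<in> U"
    and H: "continuous_map (prod_topology unit_interval (subtopology (power_space n X) U))
              (power_space n X) H"
    and equiv: "\<And>p t x. p \<in> carrier G \<Longrightarrow> t \<in> {0..1} \<Longrightarrow> x \<in> U \<Longrightarrow>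
              H (t, perm_act n p x) = perm_act n p (H (t, x))"
    and H0: "\<And>x i. x \<in> U \<Longrightarrow> i \<in> {1..n} \<Longrightarrow> H (0, x) i = H (0, x) 1"
    and H1: "\<And>x. x \<in> U \<Longrightarrow> H (1, x) = x"
  shows "openin Q (q ` U) \<and>
    (\<exists>s. continuous_map (subtopology Q (q ` U)) X s \<and>
      homotopic_with (\<lambda>_. True) (subtopology Q (q ` U)) Q ((\<lambda>x. q (\<lambda>i\<in>{1..n}. x)) \<circ> s) id)"
proof -
  let ?P = "power_space n X"
  let ?PU = "subtopology ?P U" and ?QU = "subtopology Q (q ` U)"
  have UP: "U \<subseteq> topspace ?P"
    using U by (rule openin_subset)
  then have ext: "x \<in> extensional {1..n}" if "x \<in> U" for x
    using that topspace_power_space_extensional by blast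
  have same_orbit: "\<exists>p\<in>carrier G. y = perm_act n p x"
    if "q x = q y" "y \<in> topspace ?P" for x y
    using orbit_perm_act_eqD[OF G topspace_power_space_extensional[OF that(2)]] that(1)
    unfolding q_def by metis
  have saturated: "{x \<in> topspace ?P. q x \<in> q ` U} = U"
    using same_orbit inv UP by (auto; metis)
  have qU: "openin Q (q ` U)"
    unfolding Q_def openin_quotient_topology saturated using U UP by auto
  have quo: "quotient_map ?P Q q"
    unfolding Q_def by (rule quotient_map_quotient_topology)
  then have quoU: "quotient_map ?PU ?QU q"
    using quotient_map_restriction[OF _ saturated] qU by blast
  \<comment> \<open>Crossing a quotient map with the unit interval preserves it because the interval is locally
    compact Hausdorff; this is what lets the homotopy, and not only its ends, descend.\<close>
  have quoIU: "quotient_map (prod_topology unit_interval ?PU)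
      (prod_topology unit_interval ?QU) (\<lambda>(t, x). (t, q x))"
    using quotient_map_prod_right[OF _ _ quoU] locally_compact_unit_interval
      Hausdorff_unit_interval by blast
  have top_U: "topspace ?PU = U" "topspace ?QU = q ` U"
    using UP openin_subset[OF qU] by auto
  have H_top: "H (t, x) \<in> topspace ?P" if "t \<in> {0..1}" "x \<in> U" for t x
    using continuous_map_image_subset_topspace[OF H] that top_U by auto
  have one: "1 \<in> {1..n}"
    using n by simp
  have "continuous_map ?PU X (\<lambda>x. H (0, x) 1)"
  proof -
    have "continuous_map ?PU (prod_topology unit_interval ?PU) (\<lambda>x. (0, x))"
      by (auto simp: continuous_map_pairwise comp_def)
    moreover have "continuous_map ?P X (\<lambda>y. y 1)"
      unfolding power_space_def using one by (rule continuous_map_product_coordinates)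
    ultimately have "continuous_map ?PU X ((\<lambda>y. y 1) \<circ> (H \<circ> (\<lambda>x. (0, x))))"
      by (rule continuous_map_compose[OF continuous_map_compose[OF _ H]])
    then show ?thesis
      by (simp add: comp_def)
  qed
  moreover have "H (0, x) 1 = H (0, y) 1"
    if xy: "x \<in> topspace ?PU" "y \<in> topspace ?PU" "q x = q y" for x y
  proof -
    obtain p where p: "p \<in> carrier G" "y = perm_act n p x"
      using same_orbit[OF xy(3)] xy(2) unfolding topspace_subtopology by blast
    then have "p permutes {1..n}"
      using subgroup.mem_carrier[OF G] by (simp add: sym_group_carrier)
    then have "inv_into UNIV p 1 \<in> {1..n}"
      using one by (rule inv_permutes_mem)
    then show ?thesis
      using equiv[of p 0 x] p xy one H0[of x "inv_into UNIV p 1"]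
      by (simp add: perm_act_def top_U)
  qed
  ultimately obtain s where s: "continuous_map ?QU X s"
    and s_q: "\<And>x. x \<in> topspace ?PU \<Longrightarrow> s (q x) = H (0, x) 1"
    by (rule quotient_map_lift_exists[OF quoU]) blast+
  have "continuous_map (prod_topology unit_interval ?PU) Q (q \<circ> H)"
    using H quotient_imp_continuous_map[OF quo] by (rule continuous_map_compose)
  moreover have "(q \<circ> H) z = (q \<circ> H) w"
    if z: "z \<in> topspace (prod_topology unit_interval ?PU)"
      and w: "w \<in> topspace (prod_topology unit_interval ?PU)"
      and eq: "(case z of (t, x) \<Rightarrow> (t, q x)) = (case w of (t, x) \<Rightarrow> (t, q x))" for z w
  proof -
    obtain t x y where zw: "z = (t, x)" "w = (t, y)" "q x = q y"
      using eq by (cases z, cases w) auto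
    then have t: "t \<in> {0..1}" and x: "x \<in> U" and y: "y \<in> U"
      using z w by (auto simp: top_U)
    obtain p where p: "p \<in> carrier G" "y = perm_act n p x"
      using same_orbit[of x y] zw y UP by blast
    then show ?thesis
      using orbit_perm_act[OF G p(1), of "H (t, x)"] equiv[OF p(1) t x] zw by (simp add: q_def)
  qed
  ultimately obtain h where h: "continuous_map (prod_topology unit_interval ?QU) Q h"
    and h_q: "\<And>z. z \<in> topspace (prod_topology unit_interval ?PU) \<Longrightarrow>
        h (case z of (t, x) \<Rightarrow> (t, q x)) = (q \<circ> H) z"
    by (rule quotient_map_lift_exists[OF quoIU]) blast+
  have h_q': "h (t, q x) = q (H (t, x))" if "t \<in> {0..1}" "x \<in> U" for t x
    using h_q[of "(t, x)"] that UP by auto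
  have s_q': "s (q x) = H (0, x) 1" if "x \<in> U" for x
    using s_q[of x] that UP by auto
  have "homotopic_with (\<lambda>_. True) ?QU Q ((\<lambda>x. q (\<lambda>i\<in>{1..n}. x)) \<circ> s) id"
  proof (subst homotopic_with)
    show "\<exists>h. continuous_map (prod_topology unit_interval ?QU) Q h \<and>
        (\<forall>x\<in>topspace ?QU. h (0, x) = ((\<lambda>x. q (\<lambda>i\<in>{1..n}. x)) \<circ> s) x) \<and>
        (\<forall>x\<in>topspace ?QU. h (1, x) = id x) \<and> (\<forall>t\<in>{0..1}. True)"
    proof (intro exI[of _ h] conjI ballI h)
      fix v
      assume "v \<in> topspace ?QU"
      then obtain x where x: "x \<in> U" "v = q x"
        by (auto simp: top_U)
      have "(\<lambda>i\<in>{1..n}. H (0, x) 1) = H (0, x)"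
      proof (rule extensionalityI)
        show "H (0, x) \<in> extensional {1..n}"
          using topspace_power_space_extensional[OF H_top[OF _ x(1), of 0]] by simp
        show "(\<lambda>i\<in>{1..n}. H (0, x) 1) i = H (0, x) i" if "i \<in> {1..n}" for i
          using H0[OF x(1) that] that by simp
      qed simp
      then show "h (0, v) = ((\<lambda>x. q (\<lambda>i\<in>{1..n}. x)) \<circ> s) v"
        using h_q'[of 0 x] s_q'[of x] x by simp
      show "h (1, v) = id v"
        using h_q'[of 1 x] H1 x by simp
    qed auto
  qed auto
  then show ?thesis
    using qU s by blast
qed

text \<open>The condition \<open>equiv\<close> is equivariance of \<open>s\<close> read off along the paths: permuting the entries of
  \<open>x\<close> by \<open>p\<close> amounts to relabelling the paths \<open>\<gamma> i\<close> by the inverse of \<open>p\<close>.  In this form it does not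
  refer to an action on \<open>Z\<close>, so it serves both the wedge and the interval.\<close>

lemma equivariant_motion_planner_descends:
  fixes n :: nat and X :: "'a topology" and G :: "(nat \<Rightarrow> nat) monoid" and Z :: "'z topology"
  defines "q \<equiv> orbit G (perm_act n)"
  defines "Q \<equiv> quotient_topology (power_space n X) q"
  assumes G: "subgroup (carrier G) (sym_group n)" and n: "1 \<le> n"
    and U: "openin (power_space n X) U"
    and inv: "\<And>p x. p \<in> carrier G \<Longrightarrow> x \<in> U \<Longrightarrow> perm_act n p x \<in> U"
    and s: "continuous_map (subtopology (power_space n X) U) (mapping_space Z X) s"
    and \<gamma>: "\<And>i. i \<in> {1..n} \<Longrightarrow> continuous_map unit_interval Z (\<gamma> i)"
    and start: "\<And>i. i \<in> {1..n} \<Longrightarrow> \<gamma> i 0 = base"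
    and equiv: "\<And>p t x i. p \<in> carrier G \<Longrightarrow> t \<in> {0..1} \<Longrightarrow> x \<in> U \<Longrightarrow> i \<in> {1..n} \<Longrightarrow>
              s (perm_act n p x) (\<gamma> i t) = s x (\<gamma> (inv_into UNIV p i) t)"
    and finish: "\<And>x i. x \<in> U \<Longrightarrow> i \<in> {1..n} \<Longrightarrow> s x (\<gamma> i 1) = x i"
  shows "openin Q (q ` U) \<and>
    (\<exists>s. continuous_map (subtopology Q (q ` U)) X s \<and>
      homotopic_with (\<lambda>_. True) (subtopology Q (q ` U)) Q ((\<lambda>x. q (\<lambda>i\<in>{1..n}. x)) \<circ> s) id)"
  unfolding Q_def q_def
proof (rule equivariant_contraction_descends[OF G n U])
  let ?H = "\<lambda>(t, x). \<lambda>i\<in>{1..n}. s x (\<gamma> i t)"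
  have "continuous_map (prod_topology unit_interval (subtopology (power_space n X) U)) X
      (\<lambda>(t, x). s x (\<gamma> i t))" if "i \<in> {1..n}" for i
    using continuous_map_eval_along[OF s \<gamma>[OF that] locally_compact_unit_interval
        Hausdorff_unit_interval] .
  then show "continuous_map (prod_topology unit_interval (subtopology (power_space n X) U))
      (power_space n X) ?H"
    unfolding power_space_def
    by (subst continuous_map_componentwise) (auto simp: case_prod_unfold)
  fix x
  assume x: "x \<in> U"
  show "perm_act n p x \<in> U" if "p \<in> carrier G" for p
    using that x by (rule inv)
  show "?H (0, x) i = ?H (0, x) 1" if "i \<in> {1..n}" for i
    using that n start by auto
  have "x \<in> extensional {1..n}"
    using openin_subset[OF U] topspace_power_space_extensional x by blast
  then show "?H (1, x) = x"
    using finish[OF x] by (auto simp: fun_eq_iff extensional_def)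
  fix p and t :: real
  assume p: "p \<in> carrier G" and t: "t \<in> {0..1}"
  then have "p permutes {1..n}"
    using subgroup.mem_carrier[OF G] by (simp add: sym_group_carrier)
  then have "inv_into UNIV p i \<in> {1..n}" if "i \<in> {1..n}" for i
    using that by (rule inv_permutes_mem)
  then show "?H (t, perm_act n p x) = perm_act n p (?H (t, x))"
    using equiv[OF p t x] by (auto simp: perm_act_def fun_eq_iff)
qed

section \<open>The three inequalities\<close>

text \<open>Each interval of the wedge is itself the path from the base point, which every permutation
  fixes, to the point where the planner takes the value of an entry.\<close>

lemma secat_diag_SP_le_TC_Sigma:
  assumes "1 \<le> n"
  shows "secat X (SP n X) (diag_SP n) \<le> TC_Sigma n X"
  unfolding secat_def TC_Sigma_def
proof (rule cover_number_image_le[where q = "orbit (sym_group n) (perm_act n)"])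
  show "orbit (sym_group n) (perm_act n) ` topspace (power_space n X) = topspace (SP n X)"
    by (simp add: SP_def topspace_quotient_topology)
  fix U
  assume U: "openin (power_space n X) U"
    and "(\<forall>p\<in>carrier (sym_group n). perm_act n p ` U = U) \<and>
     (\<exists>s. continuous_map (subtopology (power_space n X) U) (mapping_space (wedge_space n) X) s \<and>
        (\<forall>p\<in>carrier (sym_group n). \<forall>x\<in>U. s (perm_act n p x) = wedge_perm_act n p (s x)) \<and>
        (\<forall>x\<in>U. wedge_eval n (s x) = x))"
  then obtain s where inv: "\<And>p. p \<in> carrier (sym_group n) \<Longrightarrow> perm_act n p ` U = U"
    and s: "continuous_map (subtopology (power_space n X) U) (mapping_space (wedge_space n) X) s"
    and equiv: "\<And>p x. p \<in> carrier (sym_group n) \<Longrightarrow> x \<in> U \<Longrightarrow>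
        s (perm_act n p x) = wedge_perm_act n p (s x)"
    and eval: "\<And>x. x \<in> U \<Longrightarrow> wedge_eval n (s x) = x"
    by blast
  let ?\<gamma> = "\<lambda>i t. wedge_class n (i, t)"
  have diag: "diag_SP n = (\<lambda>x. orbit (sym_group n) (perm_act n) (\<lambda>i\<in>{1..n}. x))"
    by (simp add: diag_SP_def fun_eq_iff)
  have quo: "continuous_map (sum_topology (\<lambda>_. unit_interval) {1..n}) (wedge_space n) (wedge_class n)"
    unfolding wedge_space_def by (rule quotient_imp_continuous_map[OF quotient_map_quotient_topology])
  have top: "?\<gamma> i t \<in> topspace (wedge_space n)" if "i \<in> {1..n}" "t \<in> {0..1}" for i t
    using that by (auto simp: wedge_space_def topspace_quotient_topology)
  show "openin (SP n X) (orbit (sym_group n) (perm_act n) ` U) \<and>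
    (\<exists>s. continuous_map (subtopology (SP n X) (orbit (sym_group n) (perm_act n) ` U)) X s \<and>
      homotopic_with (\<lambda>_. True) (subtopology (SP n X) (orbit (sym_group n) (perm_act n) ` U))
        (SP n X) (diag_SP n \<circ> s) id)"
    unfolding SP_def diag
  proof (rule equivariant_motion_planner_descends[OF _ assms U _ s, where \<gamma> = ?\<gamma>
        and base = "{1..n} \<times> {0}"])
    show "subgroup (carrier (sym_group n)) (sym_group n)"
      by (simp add: group.subgroup_self sym_group_is_group)
    show "perm_act n p x \<in> U" if "p \<in> carrier (sym_group n)" "x \<in> U" for p x
      using inv that by blast
    fix i
    assume i: "i \<in> {1..n}"
    show "continuous_map unit_interval (wedge_space n) (?\<gamma> i)"
      using continuous_map_compose[OF continuous_map_component_injection[OF i] quo]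
      by (simp add: comp_def)
    show "?\<gamma> i 0 = {1..n} \<times> {0}"
      by (simp add: wedge_class_def)
    fix x
    assume x: "x \<in> U"
    show "s x (?\<gamma> i 1) = x i"
      using fun_cong[OF eval[OF x], of i] i by (simp add: wedge_eval_def)
    fix p and t :: real
    assume p: "p \<in> carrier (sym_group n)" and t: "t \<in> {0..1}"
    \<comment> \<open>The base point of the wedge is the class \<open>{1..n} \<times> {0}\<close>, so the case \<open>t = 0\<close> needs that a
      permutation preserves this set; for \<open>t > 0\<close> classes are singletons.\<close>
    then have "inv_into UNIV p ` {1..n} = {1..n}"
      using permutes_image[OF permutes_inv] sym_group_carrier by blast
    moreover have "(\<lambda>(i, t). (inv_into UNIV p i, t)) ` ({1..n} \<times> {0 :: real}) =
        (inv_into UNIV p ` {1..n}) \<times> {0}"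
      by force
    ultimately have "(\<lambda>(i, t). (inv_into UNIV p i, t)) ` ?\<gamma> i t = ?\<gamma> (inv_into UNIV p i) t"
      by (simp add: wedge_class_def)
    then show "s (perm_act n p x) (?\<gamma> i t) = s x (?\<gamma> (inv_into UNIV p i) t)"
      using equiv[OF p x] top[OF i t] by (simp add: wedge_perm_act_def)
  qed
qed

lemma beta_perm_involution: "beta_perm n (beta_perm n i) = i"
  by (auto simp: beta_perm_def)

lemma inv_beta_perm: "inv_into UNIV (beta_perm n) = beta_perm n"
  by (rule inv_unique_comp) (auto simp: beta_perm_involution fun_eq_iff)

lemma beta_perm_in_sym_group: "beta_perm n \<in> carrier (sym_group n)"
  unfolding sym_group_carrier
  by (rule bij_imp_permutes[OF bij_betw_byWitness[where f' = "beta_perm n"]])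
     (auto simp: beta_perm_involution, auto simp: beta_perm_def)

lemma subgroup_beta_group: "subgroup (carrier (beta_group n)) (sym_group n)"
  by (simp add: group.subgroup_subgroup_generated sym_group_is_group)

lemma carrier_beta_group_subset: "carrier (beta_group n) \<subseteq> {id, beta_perm n}"
proof
  fix p
  assume "p \<in> carrier (beta_group n)"
  then have "p \<in> generate (sym_group n) {beta_perm n}"
    using beta_perm_in_sym_group by (simp add: carrier_subgroup_generated)
  then show "p \<in> {id, beta_perm n}"
  proof induction
    case (inv h)
    then show ?case
      by (simp add: beta_perm_in_sym_group inv_beta_perm)
  next
    case (eng g h)
    then show ?case
      by (auto simp: sym_group_mult fun_eq_iff beta_perm_involution)
  qed (auto simp: sym_group_one)
qed

text \<open>The reversal of the interval fixes only its midpoint, so the contraction has to shrink all nodes of the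
  path to \<open>1/2\<close>.  Linear shrinking keeps the \<open>i\<close>-th and \<open>(n+1-i)\<close>-th moving nodes
  symmetric about the midpoint at all times, which is the required equivariance.  The bound
  \<open>2 \<le> n\<close> keeps the denominator \<open>n - 1\<close> of the nodes nonzero.\<close>

lemma secat_diag_betaP_le_TC_beta:
  assumes n: "2 \<le> n"
  shows "secat X (betaP n X) (diag_betaP n) \<le> TC_beta n X"
  unfolding secat_def TC_beta_def
proof (rule cover_number_image_le[where q = "orbit (beta_group n) (perm_act n)"])
  show "orbit (beta_group n) (perm_act n) ` topspace (power_space n X) = topspace (betaP n X)"
    by (simp add: betaP_def topspace_quotient_topology)
  fix U
  assume U: "openin (power_space n X) U"
    and "perm_act n (beta_perm n) ` U = U \<and>
     (\<exists>s. continuous_map (subtopology (power_space n X) U) (path_space X) s \<and>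
        (\<forall>x\<in>U. s (perm_act n (beta_perm n) x) = path_rev (s x)) \<and>
        (\<forall>x\<in>U. path_eval n (s x) = x))"
  then obtain s where inv: "perm_act n (beta_perm n) ` U = U"
    and s: "continuous_map (subtopology (power_space n X) U) (mapping_space unit_interval X) s"
    and equiv: "\<And>x. x \<in> U \<Longrightarrow> s (perm_act n (beta_perm n) x) = path_rev (s x)"
    and eval: "\<And>x. x \<in> U \<Longrightarrow> path_eval n (s x) = x"
    unfolding path_space_def by blast
  define node :: "nat \<Rightarrow> real" where "node i = (real i - 1) / (real n - 1)" for i
  define \<gamma> where "\<gamma> i t = (1 - t) / 2 + t * node i" for i and t :: real
  have node: "0 \<le> node i" "node i \<le> 1" if "i \<in> {1..n}" for i
    using that n by (auto simp: node_def divide_simps)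
  have node_beta: "node (beta_perm n i) = 1 - node i" if "i \<in> {1..n}" for i
    using that n by (simp add: node_def beta_perm_def of_nat_diff divide_simps)
  have \<gamma>_beta: "\<gamma> (beta_perm n i) t = 1 - \<gamma> i t" if "i \<in> {1..n}" for i t
    unfolding \<gamma>_def node_beta[OF that] by (simp add: field_simps)
  have \<gamma>_in: "\<gamma> i t \<in> {0..1}" if "i \<in> {1..n}" "t \<in> {0..1}" for i t
  proof -
    have "0 \<le> t * node i" "t * node i \<le> t"
      using node[OF that(1)] that(2) by (auto simp: mult_left_le)
    then show ?thesis
      using that(2) by (auto simp: \<gamma>_def field_simps)
  qed
  have ext: "x \<in> extensional {1..n}" if "x \<in> U" for x
    using openin_subset[OF U] topspace_power_space_extensional that by blast
  have cases: "p = id \<or> p = beta_perm n" if "p \<in> carrier (beta_group n)" for p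
    using carrier_beta_group_subset that by blast
  have diag: "diag_betaP n = (\<lambda>x. orbit (beta_group n) (perm_act n) (\<lambda>i\<in>{1..n}. x))"
    by (simp add: diag_betaP_def fun_eq_iff)
  have n1: "1 \<le> n"
    using n by simp
  show "openin (betaP n X) (orbit (beta_group n) (perm_act n) ` U) \<and>
    (\<exists>s. continuous_map (subtopology (betaP n X) (orbit (beta_group n) (perm_act n) ` U)) X s \<and>
      homotopic_with (\<lambda>_. True) (subtopology (betaP n X) (orbit (beta_group n) (perm_act n) ` U))
        (betaP n X) (diag_betaP n \<circ> s) id)"
    unfolding betaP_def diag
  proof (rule equivariant_motion_planner_descends[OF subgroup_beta_group n1 U _ s, where \<gamma> = \<gamma>
        and base = "1 / 2"])
    show "perm_act n p x \<in> U" if "p \<in> carrier (beta_group n)" "x \<in> U" for p x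
      using cases[OF that(1)] perm_act_id[OF ext[OF that(2)]] that(2) inv by auto
    fix i
    assume i: "i \<in> {1..n}"
    have "continuous_on {0..1} (\<gamma> i)"
      unfolding \<gamma>_def by (intro continuous_intros) auto
    then show "continuous_map unit_interval unit_interval (\<gamma> i)"
      using \<gamma>_in[OF i] by auto
    show "\<gamma> i 0 = 1 / 2"
      by (simp add: \<gamma>_def)
    fix x
    assume x: "x \<in> U"
    show "s x (\<gamma> i 1) = x i"
      using fun_cong[OF eval[OF x], of i] i by (simp add: path_eval_def \<gamma>_def node_def)
    fix p and t :: real
    assume p: "p \<in> carrier (beta_group n)" and t: "t \<in> {0..1}"
    show "s (perm_act n p x) (\<gamma> i t) = s x (\<gamma> (inv_into UNIV p i) t)"
      using cases[OF p]
    proof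
      assume "p = id"
      then show ?thesis
        using perm_act_id[OF ext[OF x]] by (simp add: inv_id)
    next
      assume "p = beta_perm n"
      then show ?thesis
        using equiv[OF x] \<gamma>_in[OF i t] \<gamma>_beta[OF i] by (simp add: inv_beta_perm path_rev_def)
    qed
  qed
qed

lemma secat_comp_le:
  assumes "continuous_map E E' f" and "\<And>x. x \<in> topspace E \<Longrightarrow> p' (f x) = p x"
  shows "secat E' B p' \<le> secat E B p"
  unfolding secat_def
proof (rule cover_number_image_le[where q = id])
  fix U
  assume U: "openin B U" and "\<exists>s. continuous_map (subtopology B U) E s \<and>
     homotopic_with (\<lambda>_. True) (subtopology B U) B (p \<circ> s) id"
  then obtain s where s: "continuous_map (subtopology B U) E s"
    and hom: "homotopic_with (\<lambda>_. True) (subtopology B U) B (p \<circ> s) id"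
    by blast
  have "continuous_map (subtopology B U) E' (f \<circ> s)"
    using s assms(1) by (rule continuous_map_compose)
  moreover have "homotopic_with (\<lambda>_. True) (subtopology B U) B (p' \<circ> (f \<circ> s)) id"
  proof (rule homotopic_with_eq[OF hom])
    fix x
    assume "x \<in> topspace (subtopology B U)"
    then show "(p' \<circ> (f \<circ> s)) x = (p \<circ> s) x"
      using assms(2) continuous_map_image_subset_topspace[OF s] by auto
  qed auto
  ultimately show "openin B (id ` U) \<and> (\<exists>s. continuous_map (subtopology B (id ` U)) E' s \<and>
     homotopic_with (\<lambda>_. True) (subtopology B (id ` U)) B (p' \<circ> s) id)"
    using U by auto
qed simp

lemma continuous_map_diag_betaP: "continuous_map X (betaP n X) (diag_betaP n)"
proof -
  have "continuous_map X (power_space n X) (\<lambda>x. \<lambda>i\<in>{1..n}. x)"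
    unfolding power_space_def by (subst continuous_map_componentwise) auto
  then have "continuous_map X (betaP n X) (orbit (beta_group n) (perm_act n) \<circ> (\<lambda>x. \<lambda>i\<in>{1..n}. x))"
    unfolding betaP_def
    by (rule continuous_map_compose[OF _ quotient_imp_continuous_map[OF quotient_map_quotient_topology]])
  then show ?thesis
    by (simp add: comp_def diag_betaP_def[abs_def])
qed

lemma betaP_to_SP_diag_betaP: "betaP_to_SP n (diag_betaP n x) = diag_SP n x"
proof -
  let ?d = "\<lambda>i\<in>{1..n}. x"
  have "id \<in> carrier (beta_group n)"
    using subgroup.one_closed[OF subgroup_beta_group] by (simp add: sym_group_one)
  moreover have "orbit (sym_group n) (perm_act n) (perm_act n p ?d) = orbit (sym_group n) (perm_act n) ?d"
    if "p \<in> carrier (beta_group n)" for p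
    using that subgroup.mem_carrier[OF subgroup_beta_group]
    by (intro orbit_perm_act) (auto simp: group.subgroup_self sym_group_is_group)
  ultimately show ?thesis
    unfolding betaP_to_SP_def diag_betaP_def diag_SP_def orbit_def[of "beta_group n"] by blast
qed

theorem proposition2p13:
  fixes X :: "'a topology" and n :: nat
  assumes "CW_complex X" and "connected_space X" and "n \<ge> 2"
  shows "TC_Sigma n X \<ge> secat X (SP n X) (diag_SP n) \<and>
         TC_beta n X \<ge> secat X (betaP n X) (diag_betaP n) \<and>
         secat (betaP n X) (SP n X) (betaP_to_SP n) \<le> secat X (SP n X) (diag_SP n)"
  using secat_diag_SP_le_TC_Sigma[of n X] secat_diag_betaP_le_TC_beta[of n X] assms(3)
    secat_comp_le[of X "betaP n X" "diag_betaP n" "betaP_to_SP n" "diag_SP n" "SP n X",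
      OF continuous_map_diag_betaP betaP_to_SP_diag_betaP] by auto

end
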